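(* Let $\Omega\subset\mathbb{R}^n$ be a bounded open set with diameter $\mathsf{d}$, and let $1<p<\infty$, $\theta>0$, $\alpha\geqslant 0$, $0\leqslant\lambda<1$. Then there is a constant $C_0$, which may depend on $n,p,\lambda,\theta,\alpha$ and $\mathsf{d}$ only, such that the following holds. Let $0<\sigma<\min\left\{p-1,\frac{\lambda}{\alpha}\right\}$ and let $U$ be an operator (not necessarily linear) which is bounded in the Morrey spaces $L^{p-\varepsilon,\lambda-\alpha\varepsilon}(\Omega)$ for all $\varepsilon\in[0,\sigma]$, i.e. for each such $\varepsilon$ there is a constant $C_{p-\varepsilon,\lambda-\alpha\varepsilon}$ with $$\|Uf\|_{L^{p-\varepsilon,\lambda-\alpha\varepsilon}(\Omega)}\leqslant C_{p-\varepsilon,\lambda-\alpha\varepsilon}\,\|f\|_{L^{p-\varepsilon,\lambda-\alpha\varepsilon}(\Omega)}\qquad\text{for all } f\in L^{p-\varepsilon,\lambda-\alpha\varepsilon}(\Omega).$$ If $\sup_{0<\varepsilon<\sigma}C_{p-\varepsilon,\lambda-\alpha\varepsilon}<\infty$, then $U$ is also bounded in the grand grand Morrey space $L^{p),\lambda)}_{\theta,\alpha}(\Omega)$: $$\|Uf\|_{L^{p),\lambda)}_{\theta,\alpha}(\Omega)}\leqslant C\,\|f\|_{L^{p),\lambda)}_{\theta,\alpha}(\Omega)}\qquad\text{for all } f\in L^{p),\lambda)}_{\theta,\alpha}(\Omega),$$ with $$C=\frac{C_0}{\sigma^{\frac{\theta}{p-\sigma}}}\sup_{0<\varepsilon<\sigma}C_{p-\varepsilon,\lambda-\alpha\varepsilon}.$$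 In particular $C_0$ does not depend on $\sigma$.
   Context: Notation: $\mathsf{d}=\operatorname{diam}\Omega$, $B(x,r)=\{y\in\mathbb{R}^n:|y-x|<r\}$, $\widetilde B(x,r)=B(x,r)\cap\Omega$, and $|A|$ is the Lebesgue measure of $A$. Morrey space: for $1\leqslant q<\infty$ and $0\leqslant\mu<1$, $L^{q,\mu}(\Omega)$ is the set of measurable functions $f$ on $\Omega$ with $$\|f\|_{L^{q,\mu}(\Omega)}:=\sup_{x\in\Omega,\;0<r\leqslant\mathsf{d}}\left(\frac{1}{|B(x,r)|^{\mu}}\int_{\widetilde B(x,r)}|f(y)|^{q}\,\mathrm{d}y\right)^{1/q}<\infty.$$ Grand grand Morrey space: for $1<p<\infty$, $\theta>0$, $\alpha\geqslant0$, $0\leqslant\lambda<1$, $L^{p),\lambda)}_{\theta,\alpha}(\Omega)$ is the set of measurable functions $f$ on $\Omega$ with $$\|f\|_{L^{p),\lambda)}_{\theta,\alpha}(\Omega)}:=\sup_{0<\varepsilon<s_{\max}}\varepsilon^{\frac{\theta}{p-\varepsilon}}\|f\|_{L^{p-\varepsilon,\lambda-\alpha\varepsilon}(\Omega)}<\infty,\qquad s_{\max}=\min\left\{p-1,\frac{\lambda}{\alpha}\right\}.$$ Convention: when $\alpha=0$, the quotient $\lambda/\alpha$ is understood as $+\infty$, even if $\lambda=0$. The operator $U$ is a single map, defined on the functions belonging to the Morrey spaces $L^{p-\varepsilon,\lambda-\alpha\varepsilon}(\Omega)$, $\varepsilon\in[0,\sigma]$, with values in measurable functions on $\Omega$. 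*)

theory Defs
  imports "HOL-Analysis.Analysis"
begin

text \<open>
  Functions on \<open>\<Omega>\<close> are represented by total functions; only their values on \<open>\<Omega>\<close> enter the
  measurability conditions and the norms below.  The sort of \<open>'b\<close> covers precisely the real and
  the complex scalars (up to isometric isomorphism).  Norms are taken in \<^typ>\<open>ennreal\<close>, so that
  they make sense for every function and the supremum is \<open>\<infinity>\<close> when it diverges.
\<close>

text \<open>Real powers on \<open>[0, \<infinity>]\<close>; meant for exponents \<open>a > 0\<close> only.\<close>

definition ennreal_powr :: "ennreal \<Rightarrow> real \<Rightarrow> ennreal" where
  "ennreal_powr t a = (if t = \<infinity> then \<infinity> else ennreal (enn2real t powr a))"

definition morrey_norm ::
  "(real^'n) set \<Rightarrow> real \<Rightarrow> real \<Rightarrow> (real^'n \<Rightarrow> 'b::{real_normed_field, euclidean_space}) \<Rightarrow> ennreal"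
where
  "morrey_norm \<Omega> q \<mu> f =
     (SUP (x, r) \<in> \<Omega> \<times> {0<..diameter \<Omega>}.
        ennreal_powr
          (ennreal (1 / measure lebesgue (ball x r) powr \<mu>) *
             (\<integral>\<^sup>+y\<in>ball x r \<inter> \<Omega>. ennreal (norm (f y) powr q) \<partial>lebesgue))
          (1 / q))"

definition morrey_space ::
  "(real^'n) set \<Rightarrow> real \<Rightarrow> real \<Rightarrow> (real^'n \<Rightarrow> 'b::{real_normed_field, euclidean_space}) set"
where
  "morrey_space \<Omega> q \<mu> =
     {f. f \<in> borel_measurable (lebesgue_on \<Omega>) \<and> morrey_norm \<Omega> q \<mu> f < \<infinity>}"

text \<open>
  \<open>s\<^sub>m\<^sub>a\<^sub>x = min {p - 1, lam/\<alpha>}\<close>, where \<open>lam/\<alpha>\<close> is understood as \<open>+\<infinity>\<close> for \<open>\<alpha> = 0\<close> (even if \<open>lam = 0\<close>).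
\<close>

definition s_max :: "real \<Rightarrow> real \<Rightarrow> real \<Rightarrow> real" where
  "s_max p \<alpha> lam = (if \<alpha> = 0 then p - 1 else min (p - 1) (lam / \<alpha>))"

definition grand_morrey_norm ::
  "(real^'n) set \<Rightarrow> real \<Rightarrow> real \<Rightarrow> real \<Rightarrow> real
     \<Rightarrow> (real^'n \<Rightarrow> 'b::{real_normed_field, euclidean_space}) \<Rightarrow> ennreal"
where
  "grand_morrey_norm \<Omega> p \<theta> \<alpha> lam f =
     (SUP \<epsilon> \<in> {0<..<s_max p \<alpha> lam}.
        ennreal (\<epsilon> powr (\<theta> / (p - \<epsilon>))) * morrey_norm \<Omega> (p - \<epsilon>) (lam - \<alpha> * \<epsilon>) f)"

definition grand_morrey_space ::
  "(real^'n) set \<Rightarrow> real \<Rightarrow> real \<Rightarrow> real \<Rightarrow> real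
     \<Rightarrow> (real^'n \<Rightarrow> 'b::{real_normed_field, euclidean_space}) set"
where
  "grand_morrey_space \<Omega> p \<theta> \<alpha> lam =
     {f. f \<in> borel_measurable (lebesgue_on \<Omega>) \<and> grand_morrey_norm \<Omega> p \<theta> \<alpha> lam f < \<infinity>}"

end

theory Submission
  imports Defs
begin

text \<open>
  The operator is bounded only on the spaces with \<open>\<epsilon> \<le> \<sigma>\<close>, while the grand norm takes the supremum
  over all \<open>\<epsilon> < s\<^sub>m\<^sub>a\<^sub>x\<close>.  For \<open>\<epsilon> < \<sigma>\<close> the hypothesis applies directly, one \<open>\<epsilon>\<close> at a time.  For
  \<open>\<epsilon> \<ge> \<sigma>\<close> the norm of \<open>U f\<close> is dominated by a norm at a parameter \<open>\<eta> < \<sigma>\<close>: by Hoelder's inequality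
  on a ball \<open>B\<close>,
  \<open>(|B| powr -\<mu>1 * \<integral> |g| powr q1) powr (1/q1) \<le> |B| powr e * (|B| powr -\<mu>2 * \<integral> |g| powr q2) powr (1/q2)\<close>
  for \<open>q1 \<le> q2\<close>, with \<open>e = (1 - \<mu>1)/q1 - (1 - \<mu>2)/q2\<close>
  (lemma \<open>morrey_norm_embedding\<close>).

  Along the curve \<open>q = p - \<epsilon>\<close>, \<open>\<mu> = lam - \<alpha> \<epsilon>\<close> the quotient \<open>(1 - \<mu>)/q\<close> increases with \<open>\<epsilon>\<close>
  and stays in \<open>[0, 1]\<close> below \<open>s\<^sub>m\<^sub>a\<^sub>x\<close>.  So \<open>e \<in> [0, 1]\<close>, and the embedding constant is at most
  \<open>max 1 |B(0, d)|\<close>, whatever the two parameters are (lemma \<open>morrey_norm_embedding_curve\<close>).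

  With \<open>\<eta> = \<sigma>/2\<close> the weight lost in passing from \<open>\<epsilon>\<close> to \<open>\<eta>\<close> is
  \<open>\<epsilon> powr (\<theta>/(p-\<epsilon>)) * (\<sigma>/2) powr (-\<theta>/(p-\<sigma>/2))\<close>.  Since the exponents \<open>\<theta>/(p-\<epsilon>)\<close> lie in \<open>[0, \<theta>]\<close>
  and \<open>\<epsilon> < p - 1\<close>, the first factor is bounded in terms of \<open>p\<close> and \<open>\<theta>\<close>; up to such a bound, the second
  is at most \<open>\<sigma> powr (-\<theta>/(p-\<sigma>))\<close> (lemma \<open>powr_halved_parameter_le\<close>), which is the dependence on \<open>\<sigma>\<close>
  claimed.
\<close>

section \<open>Interpolation of integrals of powers\<close>

text \<open>
  Young's inequality with a balancing parameter \<open>N\<close>.  There is equality at \<open>t = N\<close>, so nothing is lost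
  in the constant when it is integrated with \<open>N\<close> a bound for the \<open>q2\<close>-mean of \<open>t\<close>.
\<close>

lemma powr_le_powr_interpolate:
  fixes t N q1 q2 :: real
  assumes "0 \<le> t" "0 < N" "0 < q1" "q1 \<le> q2"
  shows "t powr q1 \<le> q1 / q2 * N powr (q1 - q2) * t powr q2 + (1 - q1 / q2) * N powr q1"
proof (cases "t = 0")
  case True
  then show ?thesis using assms by simp
next
  case False
  then have t: "0 < t" using assms by simp
  have "(t powr q2) powr (q1/q2) * (N powr q2) powr (1 - q1/q2)
      \<le> q1/q2 * t powr q2 + (1 - q1/q2) * N powr q2"
    by (rule Youngs_inequality_0) (use assms t in auto)
  moreover have "(t powr q2) powr (q1/q2) = t powr q1"
    using assms by (simp add: powr_powr)
  moreover have "(N powr q2) powr (1 - q1/q2) = N powr (q2 - q1)"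
    using assms by (simp add: powr_powr algebra_simps)
  ultimately have le: "t powr q1 * N powr (q2 - q1) \<le> q1/q2 * t powr q2 + (1 - q1/q2) * N powr q2"
    by simp
  have "t powr q1 = (t powr q1 * N powr (q2 - q1)) * N powr (q1 - q2)"
    using assms by (simp add: mult.assoc powr_add[symmetric])
  also have "\<dots> \<le> (q1/q2 * t powr q2 + (1 - q1/q2) * N powr q2) * N powr (q1 - q2)"
    by (rule mult_right_mono[OF le]) simp
  also have "\<dots> = q1/q2 * N powr (q1 - q2) * t powr q2 + (1 - q1/q2) * (N powr q2 * N powr (q1 - q2))"
    by (simp add: algebra_simps)
  also have "N powr q2 * N powr (q1 - q2) = N powr q1"
    by (simp add: powr_add[symmetric])
  finally show ?thesis .
qed

text \<open>
  Hoelder's inequality for a set of measure at most \<open>v\<close>: the \<open>q1\<close>-mean of \<open>g\<close> is controlled by its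
  \<open>q2\<close>-mean.  Stating it through an upper bound \<open>N > 0\<close> for the \<open>q2\<close>-mean lets Young's inequality be
  integrated with the optimal weight and avoids a case distinction for functions vanishing almost
  everywhere.
\<close>

lemma nn_set_integral_powr_interpolate:
  fixes g :: "'a \<Rightarrow> 'b::{real_normed_vector, second_countable_topology}"
  assumes g: "g \<in> borel_measurable (restrict_space M S)"
    and A: "A \<in> sets M" "A \<subseteq> S"
    and v: "emeasure M A \<le> ennreal v" "0 \<le> v"
    and q: "0 < q1" "q1 \<le> q2" and N: "0 < N"
    and le: "(\<integral>\<^sup>+y\<in>A. ennreal (norm (g y) powr q2) \<partial>M) \<le> ennreal (v * N powr q2)"
  shows "(\<integral>\<^sup>+y\<in>A. ennreal (norm (g y) powr q1) \<partial>M) \<le> ennreal (v * N powr q1)"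
proof -
  define a where "a = q1 / q2 * N powr (q1 - q2)"
  define b where "b = (1 - q1 / q2) * N powr q1"
  have a: "0 \<le> a" and b: "0 \<le> b" using q by (auto simp: a_def b_def)
  have gA: "g \<in> borel_measurable (restrict_space M A)"
    using measurable_restrict_mono[OF g A(2)] .
  have "(\<lambda>y. ennreal (norm (g y) powr q2)) \<in> borel_measurable (restrict_space M A)"
    using gA by measurable
  then have meas: "(\<lambda>y. ennreal (norm (g y) powr q2) * indicator A y) \<in> borel_measurable M"
    using A(1) by (subst (asm) borel_measurable_restrict_space_iff_ennreal) auto
  have "(\<integral>\<^sup>+y\<in>A. ennreal (norm (g y) powr q1) \<partial>M)
      \<le> (\<integral>\<^sup>+y. ennreal a * (ennreal (norm (g y) powr q2) * indicator A y)
              + ennreal b * indicator A y \<partial>M)"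
  proof (rule nn_integral_mono)
    fix y
    have "ennreal (norm (g y) powr q1) \<le> ennreal (a * norm (g y) powr q2 + b)"
      by (rule ennreal_leI, unfold a_def b_def, rule powr_le_powr_interpolate) (use q N in auto)
    also have "\<dots> = ennreal a * ennreal (norm (g y) powr q2) + ennreal b"
      using a b by (simp add: ennreal_mult)
    finally show "ennreal (norm (g y) powr q1) * indicator A y
        \<le> ennreal a * (ennreal (norm (g y) powr q2) * indicator A y) + ennreal b * indicator A y"
      by (auto simp: indicator_def)
  qed
  also have "\<dots> = ennreal a * (\<integral>\<^sup>+y\<in>A. ennreal (norm (g y) powr q2) \<partial>M) + ennreal b * emeasure M A"
    using meas A(1) by (simp add: nn_integral_add nn_integral_cmult nn_integral_cmult_indicator)
  also have "\<dots> \<le> ennreal a * ennreal (v * N powr q2) + ennreal b * ennreal v"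
    by (intro add_mono mult_left_mono le v) auto
  also have "\<dots> = ennreal (a * (v * N powr q2) + b * v)"
    using a b v(2) by (simp add: ennreal_mult[symmetric] ennreal_plus[symmetric] del: ennreal_plus)
  also have "a * (v * N powr q2) + b * v = v * N powr q1"
  proof -
    have "N powr (q1 - q2) * N powr q2 = N powr q1"
      by (simp add: powr_add[symmetric])
    then have "a * (v * N powr q2) = q1 / q2 * v * N powr q1"
      by (simp add: a_def mult.left_commute)
    then show ?thesis by (simp add: b_def algebra_simps)
  qed
  finally show ?thesis .
qed

section \<open>Embeddings between Morrey spaces\<close>

lemma ennreal_powr_inverse_le_iff:
  assumes "0 < q" "0 \<le> N"
  shows "ennreal_powr t (1 / q) \<le> ennreal N \<longleftrightarrow> t \<le> ennreal (N powr q)"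
proof (cases t)
  case (real r)
  have "r powr (1/q) \<le> N \<longleftrightarrow> r \<le> N powr q"
  proof
    assume "r powr (1/q) \<le> N"
    then have "(r powr (1/q)) powr q \<le> N powr q"
      by (rule powr_mono2[rotated 2]) (use assms in auto)
    then show "r \<le> N powr q" using assms real by (simp add: powr_powr)
  next
    assume "r \<le> N powr q"
    then have "r powr (1/q) \<le> (N powr q) powr (1/q)"
      by (rule powr_mono2[rotated 2]) (use assms real in auto)
    then show "r powr (1/q) \<le> N" using assms real by (simp add: powr_powr)
  qed
  then show ?thesis using assms real by (simp add: ennreal_powr_def)
next
  case top
  then show ?thesis by (simp add: ennreal_powr_def top_unique)
qed

lemma content_ball_mono_radius:
  fixes x y :: "'a::euclidean_space"
  assumes "0 \<le> r" "r \<le> d"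
  shows "measure lebesgue (ball x r) \<le> measure lebesgue (ball y d)"
proof -
  have "measure lborel (ball x r) \<le> measure lborel (ball y d)"
    using assms
    by (simp add: content_ball_conv_unit_ball[of r x] content_ball_conv_unit_ball[of d y]
        mult_right_mono power_mono)
  then show ?thesis by simp
qed

text \<open>
  Removing the roots and the supremum turns estimates between Morrey norms into estimates between
  the integrals over a single ball.
\<close>

lemma morrey_norm_le_iff:
  fixes \<Omega> :: "(real^'n) set" and f :: "real^'n \<Rightarrow> 'b::{real_normed_field, euclidean_space}"
  assumes "0 < q" "0 \<le> N"
  shows "morrey_norm \<Omega> q \<mu> f \<le> ennreal N \<longleftrightarrow>
    (\<forall>x\<in>\<Omega>. \<forall>r. 0 < r \<longrightarrow> r \<le> diameter \<Omega> \<longrightarrow>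
       (\<integral>\<^sup>+y\<in>ball x r \<inter> \<Omega>. ennreal (norm (f y) powr q) \<partial>lebesgue)
         \<le> ennreal (measure lebesgue (ball x r) powr \<mu> * N powr q))"
proof -
  have *: "ennreal (1 / v powr \<mu>) * I \<le> ennreal (N powr q) \<longleftrightarrow> I \<le> ennreal (v powr \<mu> * N powr q)"
    if "0 < v" for v :: real and I :: ennreal
  proof (cases I)
    case (real i)
    have "1 / v powr \<mu> * i \<le> N powr q \<longleftrightarrow> i \<le> v powr \<mu> * N powr q"
      using that by (simp add: field_simps)
    then show ?thesis using real by (simp add: ennreal_mult[symmetric] del: times_divide_eq_left)
  next
    case top
    then show ?thesis using that by (simp add: ennreal_mult_top top_unique)
  qed
  show ?thesis
    unfolding morrey_norm_def SUP_le_iff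
    by (auto simp: ennreal_powr_inverse_le_iff[OF assms] * content_ball_pos)
qed

text \<open>
  The exponent \<open>(1 - \<mu>1)/q1 - (1 - \<mu>2)/q2\<close> is the power of \<open>|B|\<close> that Hoelder's inequality leaves over;
  its nonnegativity makes the factor bounded on small balls, and the bound \<open>1\<close> makes the constant
  independent of the exponents.
\<close>

lemma morrey_norm_embedding:
  fixes \<Omega> :: "(real^'n) set" and f :: "real^'n \<Rightarrow> 'b::{real_normed_field, euclidean_space}"
  assumes \<Omega>: "open \<Omega>"
    and f: "f \<in> borel_measurable (lebesgue_on \<Omega>)"
    and q: "0 < q1" "q1 \<le> q2"
    and e: "0 \<le> (1 - \<mu>1) / q1 - (1 - \<mu>2) / q2" "(1 - \<mu>1) / q1 - (1 - \<mu>2) / q2 \<le> 1"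
  shows "morrey_norm \<Omega> q1 \<mu>1 f
    \<le> ennreal (max 1 (measure lebesgue (ball (0::real^'n) (diameter \<Omega>)))) * morrey_norm \<Omega> q2 \<mu>2 f"
proof -
  define K where "K = max 1 (measure lebesgue (ball (0::real^'n) (diameter \<Omega>)))"
  define ex where "ex = (1 - \<mu>1) / q1 - (1 - \<mu>2) / q2"
  have K: "1 \<le> K" by (simp add: K_def)
  have bound: "morrey_norm \<Omega> q1 \<mu>1 f \<le> ennreal (K * N)"
    if N: "0 < N" and le: "morrey_norm \<Omega> q2 \<mu>2 f \<le> ennreal N" for N
  proof (subst morrey_norm_le_iff, safe)
    fix x r assume x: "x \<in> \<Omega>" and r: "0 < r" "r \<le> diameter \<Omega>"
    define v where "v = measure lebesgue (ball x r)"
    have v: "0 < v" using r by (simp add: v_def content_ball_pos)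
    have vK: "v \<le> K"
      using content_ball_mono_radius[of r "diameter \<Omega>" x "0::real^'n"] r by (simp add: v_def K_def)
    \<comment> \<open>bound for the \<open>q2\<close>-mean of \<open>f\<close> over the ball, relative to the full volume \<open>v\<close>\<close>
    let ?N = "N * v powr ((\<mu>2 - 1) / q2)"
    have "emeasure lebesgue (ball x r \<inter> \<Omega>) \<le> emeasure lebesgue (ball x r)"
      by (rule emeasure_mono) auto
    also have "\<dots> = ennreal v"
      unfolding v_def
      by (rule emeasure_eq_ennreal_measure) (use emeasure_lborel_ball_finite[of x r] in \<open>auto simp: less_top\<close>)
    finally have em: "emeasure lebesgue (ball x r \<inter> \<Omega>) \<le> ennreal v" .
    have "(\<integral>\<^sup>+y\<in>ball x r \<inter> \<Omega>. ennreal (norm (f y) powr q2) \<partial>lebesgue) \<le> ennreal (v powr \<mu>2 * N powr q2)"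
      using le x r morrey_norm_le_iff[of q2 N \<Omega> \<mu>2 f] q N by (auto simp: v_def)
    also have "v powr \<mu>2 * N powr q2 = v * ?N powr q2"
    proof -
      have "v * v powr (\<mu>2 - 1) = v powr \<mu>2"
        using v by (simp add: powr_diff)
      moreover have "(v powr ((\<mu>2 - 1) / q2)) powr q2 = v powr (\<mu>2 - 1)"
        using q by (simp add: powr_powr)
      ultimately show ?thesis using N v by (simp add: powr_mult mult.left_commute)
    qed
    finally have "(\<integral>\<^sup>+y\<in>ball x r \<inter> \<Omega>. ennreal (norm (f y) powr q1) \<partial>lebesgue) \<le> ennreal (v * ?N powr q1)"
      by (intro nn_set_integral_powr_interpolate[OF f _ _ em _ q]) (use \<Omega> v N in auto)
    also have "v * ?N powr q1 = v powr \<mu>1 * (v powr ex * N) powr q1"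
    proof -
      have "v * v powr ((\<mu>2 - 1) / q2 * q1) = v powr (1 + (\<mu>2 - 1) / q2 * q1)"
        using v by (simp add: powr_add)
      also have "1 + (\<mu>2 - 1) / q2 * q1 = \<mu>1 + ex * q1"
        using q by (simp add: ex_def field_simps)
      finally have "v * v powr ((\<mu>2 - 1) / q2 * q1) = v powr \<mu>1 * v powr (ex * q1)"
        by (simp add: powr_add)
      then show ?thesis using N v by (simp add: powr_mult powr_powr algebra_simps)
    qed
    also have "ennreal (v powr \<mu>1 * (v powr ex * N) powr q1) \<le> ennreal (v powr \<mu>1 * (K * N) powr q1)"
    proof -
      have "v powr ex \<le> K powr ex"
        using e v vK by (intro powr_mono2) (auto simp: ex_def)
      also have "\<dots> \<le> K powr 1"
        using e K by (intro powr_mono) (auto simp: ex_def)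
      finally have "v powr ex \<le> K" using K by simp
      then show ?thesis
        using N q by (intro ennreal_leI mult_left_mono powr_mono2 mult_right_mono) auto
    qed
    finally show "(\<integral>\<^sup>+y\<in>ball x r \<inter> \<Omega>. ennreal (norm (f y) powr q1) \<partial>lebesgue)
        \<le> ennreal (measure lebesgue (ball x r) powr \<mu>1 * (K * N) powr q1)"
      by (simp add: v_def)
  qed (use q K N in auto)
  show ?thesis
    unfolding K_def[symmetric]
  \<comment> \<open>The interpolation needs a positive bound, but the norm may vanish: approach it from above.\<close>
  proof (rule ennreal_le_epsilon)
    fix \<delta> :: real
    assume fin: "ennreal K * morrey_norm \<Omega> q2 \<mu>2 f < top" and \<delta>: "0 < \<delta>"
    then obtain m where m: "morrey_norm \<Omega> q2 \<mu>2 f = ennreal m" "0 \<le> m"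
      using K by (cases "morrey_norm \<Omega> q2 \<mu>2 f") (auto simp: ennreal_mult_top)
    have "morrey_norm \<Omega> q1 \<mu>1 f \<le> ennreal (K * (m + \<delta> / K))"
      by (rule bound) (use m \<delta> K in \<open>auto intro!: ennreal_leI add_nonneg_pos\<close>)
    also have "K * (m + \<delta> / K) = K * m + \<delta>"
      using K by (simp add: field_simps)
    also have "ennreal \<dots> = ennreal K * morrey_norm \<Omega> q2 \<mu>2 f + ennreal \<delta>"
      using m \<delta> K by (simp add: ennreal_mult)
    finally show "morrey_norm \<Omega> q1 \<mu>1 f \<le> ennreal K * morrey_norm \<Omega> q2 \<mu>2 f + ennreal \<delta>" .
  qed
qed

lemma s_max_bounds:
  assumes "0 \<le> \<alpha>" "0 \<le> lam" "\<epsilon> < s_max p \<alpha> lam"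
  shows "\<epsilon> < p - 1" "\<alpha> * \<epsilon> \<le> lam"
  using assms by (auto simp: s_max_def field_simps split: if_splits)

text \<open>
  Both the monotonicity of \<open>(1 - lam + \<alpha> \<epsilon>)/(p - \<epsilon>)\<close> in \<open>\<epsilon>\<close> and its bound by \<open>1\<close> come from comparing
  numerators and denominators: below \<open>s_max p \<alpha> lam\<close> the former are at most \<open>1\<close>, the latter at least \<open>1\<close>.
\<close>

lemma morrey_norm_embedding_curve:
  fixes \<Omega> :: "(real^'n) set" and f :: "real^'n \<Rightarrow> 'b::{real_normed_field, euclidean_space}"
  assumes "open \<Omega>" "f \<in> borel_measurable (lebesgue_on \<Omega>)"
    and par: "0 \<le> \<alpha>" "0 \<le> lam" "lam < 1"
    and \<epsilon>: "0 \<le> \<eta>" "\<eta> \<le> \<epsilon>" "\<epsilon> < s_max p \<alpha> lam"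
  shows "morrey_norm \<Omega> (p - \<epsilon>) (lam - \<alpha> * \<epsilon>) f
    \<le> ennreal (max 1 (measure lebesgue (ball (0::real^'n) (diameter \<Omega>))))
        * morrey_norm \<Omega> (p - \<eta>) (lam - \<alpha> * \<eta>) f"
proof -
  note b = s_max_bounds[OF par(1,2) \<epsilon>(3)]
  have ae: "0 \<le> \<alpha> * \<eta>" "\<alpha> * \<eta> \<le> \<alpha> * \<epsilon>"
    using par \<epsilon> by (auto intro: mult_left_mono)
  have "(1 - (lam - \<alpha> * \<eta>)) / (p - \<eta>) \<le> (1 - (lam - \<alpha> * \<epsilon>)) / (p - \<epsilon>)"
    using b ae par \<epsilon> by (intro frac_le) linarith+
  moreover have "(1 - (lam - \<alpha> * \<epsilon>)) / (p - \<epsilon>) \<le> 1"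
    using b ae by simp
  moreover have "0 \<le> (1 - (lam - \<alpha> * \<eta>)) / (p - \<eta>)"
    using b ae par \<epsilon> by (intro divide_nonneg_nonneg) linarith+
  ultimately show ?thesis
    using b \<epsilon> by (intro morrey_norm_embedding assms(1,2)) linarith+
qed

section \<open>Boundedness in the grand grand Morrey space\<close>

lemma weighted_morrey_norm_le_grand:
  assumes "0 < \<epsilon>" "\<epsilon> < s_max p \<alpha> lam"
  shows "ennreal (\<epsilon> powr (\<theta> / (p - \<epsilon>))) * morrey_norm \<Omega> (p - \<epsilon>) (lam - \<alpha> * \<epsilon>) f
    \<le> grand_morrey_norm \<Omega> p \<theta> \<alpha> lam f"
  unfolding grand_morrey_norm_def by (rule SUP_upper) (use assms in auto)

lemma morrey_norm_le_grand:
  assumes "0 < \<epsilon>" "\<epsilon> < s_max p \<alpha> lam"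
  shows "morrey_norm \<Omega> (p - \<epsilon>) (lam - \<alpha> * \<epsilon>) f
    \<le> ennreal (\<epsilon> powr - (\<theta> / (p - \<epsilon>))) * grand_morrey_norm \<Omega> p \<theta> \<alpha> lam f"
proof -
  have "morrey_norm \<Omega> (p - \<epsilon>) (lam - \<alpha> * \<epsilon>) f
      = ennreal (\<epsilon> powr - (\<theta> / (p - \<epsilon>)))
          * (ennreal (\<epsilon> powr (\<theta> / (p - \<epsilon>))) * morrey_norm \<Omega> (p - \<epsilon>) (lam - \<alpha> * \<epsilon>) f)"
    using assms by (simp add: mult.assoc[symmetric] ennreal_mult[symmetric] powr_add[symmetric])
  also have "\<dots> \<le> ennreal (\<epsilon> powr - (\<theta> / (p - \<epsilon>))) * grand_morrey_norm \<Omega> p \<theta> \<alpha> lam f"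
    by (intro mult_left_mono weighted_morrey_norm_le_grand assms) simp
  finally show ?thesis .
qed

lemma grand_morrey_space_subset_morrey_space:
  assumes "0 < \<epsilon>" "\<epsilon> < s_max p \<alpha> lam"
  shows "grand_morrey_space \<Omega> p \<theta> \<alpha> lam \<subseteq> morrey_space \<Omega> (p - \<epsilon>) (lam - \<alpha> * \<epsilon>)"
proof
  fix f assume f: "f \<in> grand_morrey_space \<Omega> p \<theta> \<alpha> lam"
  then have "ennreal (\<epsilon> powr - (\<theta> / (p - \<epsilon>))) * grand_morrey_norm \<Omega> p \<theta> \<alpha> lam f < \<infinity>"
    by (simp add: grand_morrey_space_def ennreal_mult_less_top)
  with morrey_norm_le_grand[OF assms, of \<Omega> f \<theta>] f
  show "f \<in> morrey_space \<Omega> (p - \<epsilon>) (lam - \<alpha> * \<epsilon>)"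
    by (auto simp: grand_morrey_space_def morrey_space_def intro: le_less_trans)
qed

lemma powr_le_max_powr:
  fixes x a b m :: real
  assumes "0 \<le> x" "x \<le> m" "0 \<le> a" "a \<le> b"
  shows "x powr a \<le> max 1 m powr b"
proof -
  have "x powr a \<le> max 1 m powr a" using assms by (intro powr_mono2) auto
  also have "\<dots> \<le> max 1 m powr b" using assms by (intro powr_mono) auto
  finally show ?thesis .
qed

lemma weight_exponent_bounds:
  fixes p \<theta> \<epsilon> :: real
  assumes "0 < \<theta>" "\<epsilon> < p - 1"
  shows "0 \<le> \<theta> / (p - \<epsilon>)" "\<theta> / (p - \<epsilon>) \<le> \<theta>"
proof -
  show "0 \<le> \<theta> / (p - \<epsilon>)" using assms by simp
  have "\<theta> / (p - \<epsilon>) \<le> \<theta> / 1" using assms by (intro divide_left_mono) auto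
  then show "\<theta> / (p - \<epsilon>) \<le> \<theta>" by simp
qed

text \<open>
  Halving \<open>\<sigma>\<close> changes both the base and the exponent of the weight.  The base contributes at most
  \<open>2 powr \<theta>\<close>; the exponent changes by an amount in \<open>[0, \<theta>]\<close>, and \<open>\<sigma>\<close> to that power is bounded.
\<close>

lemma powr_halved_parameter_le:
  fixes p \<theta> \<sigma> :: real
  assumes "0 < \<theta>" "0 < \<sigma>" "\<sigma> < p - 1"
  shows "(\<sigma> / 2) powr - (\<theta> / (p - \<sigma> / 2))
    \<le> 2 powr \<theta> * max 1 (p - 1) powr \<theta> / \<sigma> powr (\<theta> / (p - \<sigma>))"
proof -
  define s t where "s = \<theta> / (p - \<sigma>)" and "t = \<theta> / (p - \<sigma> / 2)"
  have s: "0 \<le> s" "s \<le> \<theta>" using weight_exponent_bounds[of \<theta> \<sigma> p] assms by (auto simp: s_def)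
  have t: "0 \<le> t" "t \<le> \<theta>" using weight_exponent_bounds[of \<theta> "\<sigma>/2" p] assms by (auto simp: t_def)
  have ts: "t \<le> s" unfolding s_def t_def using assms by (intro divide_left_mono) auto
  have "(\<sigma> / 2) powr - t = 2 powr t * \<sigma> powr (s - t) / \<sigma> powr s"
    using assms by (simp add: powr_minus powr_divide powr_diff field_simps)
  also have "\<dots> \<le> 2 powr \<theta> * max 1 (p - 1) powr \<theta> / \<sigma> powr s"
    using s t ts assms
    by (intro divide_right_mono mult_mono powr_mono powr_le_max_powr) auto
  finally show ?thesis by (simp add: s_def t_def)
qed

theorem lemma3p6:
  fixes p \<theta> \<alpha> lam d :: real
  assumes "1 < p" and "0 < \<theta>" and "0 \<le> \<alpha>" and "0 \<le> lam" and "lam < 1"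
  shows "\<exists>C0::real. 0 < C0 \<and>
    (\<forall>(\<Omega> :: (real^'n) set) (\<sigma>::real) (c :: real \<Rightarrow> real)
       (U :: (real^'n \<Rightarrow> 'b::{real_normed_field, euclidean_space}) \<Rightarrow> (real^'n \<Rightarrow> 'b)).
       open \<Omega> \<longrightarrow> bounded \<Omega> \<longrightarrow> diameter \<Omega> = d \<longrightarrow>
       0 < \<sigma> \<longrightarrow> \<sigma> < s_max p \<alpha> lam \<longrightarrow>
       (\<forall>\<epsilon>\<in>{0..\<sigma>}. 0 \<le> c \<epsilon> \<and>
          (\<forall>f\<in>morrey_space \<Omega> (p - \<epsilon>) (lam - \<alpha> * \<epsilon>).
             U f \<in> borel_measurable (lebesgue_on \<Omega>) \<and>
             morrey_norm \<Omega> (p - \<epsilon>) (lam - \<alpha> * \<epsilon>) (U f)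
               \<le> ennreal (c \<epsilon>) * morrey_norm \<Omega> (p - \<epsilon>) (lam - \<alpha> * \<epsilon>) f)) \<longrightarrow>
       bdd_above (c ` {0<..<\<sigma>}) \<longrightarrow>
       (\<forall>f\<in>grand_morrey_space \<Omega> p \<theta> \<alpha> lam.
          U f \<in> grand_morrey_space \<Omega> p \<theta> \<alpha> lam \<and>
          grand_morrey_norm \<Omega> p \<theta> \<alpha> lam (U f)
            \<le> ennreal (C0 / \<sigma> powr (\<theta> / (p - \<sigma>)) * (SUP \<epsilon>\<in>{0<..<\<sigma>}. c \<epsilon>))
                * grand_morrey_norm \<Omega> p \<theta> \<alpha> lam f))"
proof -
  define K where "K = max 1 (measure lebesgue (ball (0::real^'n) d))"
  define W where "W = max 1 (p - 1) powr \<theta>"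
  \<comment> \<open>\<open>K\<close> comes from the embedding, the first \<open>W\<close> from the weight at \<open>\<epsilon>\<close>, the rest from the weight at \<open>\<sigma>/2\<close>.\<close>
  define C0 where "C0 = K * W * (2 powr \<theta> * W)"
  have K: "1 \<le> K" by (simp add: K_def)
  have W: "1 \<le> W" using assms by (simp add: W_def ge_one_powr_ge_zero)
  have two: "1 \<le> (2::real) powr \<theta>" using assms by (simp add: ge_one_powr_ge_zero)
  have "1 * 1 * (1 * W) \<le> C0"
    unfolding C0_def using K W two by (intro mult_mono) auto
  then have WC: "W \<le> C0" by simp
  show ?thesis
  proof (intro exI[of _ C0] conjI allI impI ballI)
    show "0 < C0" using WC W by simp
  next
    fix \<Omega> :: "(real^'n) set" and \<sigma> :: real and c :: "real \<Rightarrow> real"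
      and U :: "(real^'n \<Rightarrow> 'b) \<Rightarrow> (real^'n \<Rightarrow> 'b)"
      and f :: "real^'n \<Rightarrow> 'b"
    assume \<Omega>: "open \<Omega>" "diameter \<Omega> = d"
      and \<sigma>: "0 < \<sigma>" "\<sigma> < s_max p \<alpha> lam"
      and U: "\<forall>\<epsilon>\<in>{0..\<sigma>}. 0 \<le> c \<epsilon> \<and>
          (\<forall>f\<in>morrey_space \<Omega> (p - \<epsilon>) (lam - \<alpha> * \<epsilon>).
             U f \<in> borel_measurable (lebesgue_on \<Omega>) \<and>
             morrey_norm \<Omega> (p - \<epsilon>) (lam - \<alpha> * \<epsilon>) (U f)
               \<le> ennreal (c \<epsilon>) * morrey_norm \<Omega> (p - \<epsilon>) (lam - \<alpha> * \<epsilon>) f)"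
      and bdd: "bdd_above (c ` {0<..<\<sigma>})"
      and f: "f \<in> grand_morrey_space \<Omega> p \<theta> \<alpha> lam"
    define S where "S = (SUP \<epsilon>\<in>{0<..<\<sigma>}. c \<epsilon>)"
    define G where "G = grand_morrey_norm \<Omega> p \<theta> \<alpha> lam f"
    define R where "R = \<sigma> powr (\<theta> / (p - \<sigma>))"
    let ?m = "\<lambda>\<epsilon>. morrey_norm \<Omega> (p - \<epsilon>) (lam - \<alpha> * \<epsilon>)"
    have \<sigma>p: "\<sigma> < p - 1" using s_max_bounds[OF assms(3,4) \<sigma>(2)] by simp
    have cS: "c \<epsilon> \<le> S" if "0 < \<epsilon>" "\<epsilon> < \<sigma>" for \<epsilon>
      unfolding S_def using that by (intro cSUP_upper bdd) auto
    have fM: "f \<in> morrey_space \<Omega> (p - \<epsilon>) (lam - \<alpha> * \<epsilon>)" if "0 < \<epsilon>" "\<epsilon> < \<sigma>" for \<epsilon>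
      using grand_morrey_space_subset_morrey_space[of \<epsilon> p \<alpha> lam \<Omega> \<theta>] that \<sigma> f by auto
    have small: "?m \<epsilon> (U f) \<le> ennreal S * ?m \<epsilon> f" if "0 < \<epsilon>" "\<epsilon> < \<sigma>" for \<epsilon>
    proof -
      have "?m \<epsilon> (U f) \<le> ennreal (c \<epsilon>) * ?m \<epsilon> f"
        using U fM[OF that] that by auto
      also have "\<dots> \<le> ennreal S * ?m \<epsilon> f"
        using cS[OF that] by (intro mult_right_mono ennreal_leI) auto
      finally show ?thesis .
    qed
    have \<eta>: "0 < \<sigma> / 2" "\<sigma> / 2 < \<sigma>" using \<sigma> by auto
    have S: "0 \<le> S" using cS[OF \<eta>] U \<eta> by (auto intro: order_trans)
    have meas: "U f \<in> borel_measurable (lebesgue_on \<Omega>)"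
      using bspec[OF U, of "\<sigma> / 2"] fM[OF \<eta>] \<eta> by auto
    have R: "0 < R" "R \<le> W"
      using powr_le_max_powr[OF _ _ weight_exponent_bounds[OF assms(2) \<sigma>p], of \<sigma> "p - 1"] \<sigma> \<sigma>p
      by (auto simp: R_def W_def)
    have "ennreal (\<epsilon> powr (\<theta> / (p - \<epsilon>))) * ?m \<epsilon> (U f) \<le> ennreal (C0 / R * S) * G"
      if \<epsilon>: "0 < \<epsilon>" "\<epsilon> < s_max p \<alpha> lam" for \<epsilon>
    proof (cases "\<epsilon> < \<sigma>")
      case True
      have "ennreal (\<epsilon> powr (\<theta> / (p - \<epsilon>))) * ?m \<epsilon> (U f)
          \<le> ennreal (\<epsilon> powr (\<theta> / (p - \<epsilon>))) * (ennreal S * ?m \<epsilon> f)"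
        by (intro mult_left_mono small \<epsilon> True) simp
      also have "\<dots> = ennreal S * (ennreal (\<epsilon> powr (\<theta> / (p - \<epsilon>))) * ?m \<epsilon> f)"
        by (simp add: mult_ac)
      also have "\<dots> \<le> ennreal S * G"
        unfolding G_def by (intro mult_left_mono weighted_morrey_norm_le_grand \<epsilon>) simp
      also have "\<dots> \<le> ennreal (C0 / R * S) * G"
      proof -
        have "1 \<le> C0 / R" using R WC by simp
        then have "1 * S \<le> C0 / R * S" using S by (intro mult_right_mono)
        then show ?thesis by (intro mult_right_mono ennreal_leI) auto
      qed
      finally show ?thesis .
    next
      case False
      have \<epsilon>p: "\<epsilon> < p - 1" using s_max_bounds[OF assms(3,4) \<epsilon>(2)] by simp
      have eW: "\<epsilon> powr (\<theta> / (p - \<epsilon>)) \<le> W"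
        using powr_le_max_powr[OF _ _ weight_exponent_bounds[OF assms(2) \<epsilon>p], of \<epsilon> "p - 1"] \<epsilon> \<epsilon>p
        by (simp add: W_def)
      have "?m \<epsilon> (U f) \<le> ennreal K * ?m (\<sigma>/2) (U f)"
        using morrey_norm_embedding_curve[OF \<Omega>(1) meas assms(3-5), of "\<sigma>/2" \<epsilon> p] \<epsilon> \<eta> False \<Omega>(2)
        by (simp add: K_def)
      also have "\<dots> \<le> ennreal K * (ennreal S * ?m (\<sigma>/2) f)"
        by (intro mult_left_mono small \<eta>) simp
      also have "\<dots> \<le> ennreal K * (ennreal S * (ennreal ((\<sigma>/2) powr - (\<theta> / (p - \<sigma>/2))) * G))"
        unfolding G_def using \<eta> \<sigma> by (intro mult_left_mono morrey_norm_le_grand) auto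
      also have "\<dots> \<le> ennreal K * (ennreal S * (ennreal (2 powr \<theta> * W / R) * G))"
        using powr_halved_parameter_le[OF assms(2) \<sigma>(1) \<sigma>p]
        by (intro mult_left_mono mult_right_mono ennreal_leI) (auto simp: W_def R_def)
      finally have "ennreal (\<epsilon> powr (\<theta> / (p - \<epsilon>))) * ?m \<epsilon> (U f)
          \<le> ennreal W * (ennreal K * (ennreal S * (ennreal (2 powr \<theta> * W / R) * G)))"
        using eW by (intro mult_mono ennreal_leI) auto
      also have "\<dots> = ennreal (W * (K * (S * (2 powr \<theta> * W / R)))) * G"
        using W K S R by (simp add: ennreal_mult[symmetric] mult.assoc[symmetric])
      also have "W * (K * (S * (2 powr \<theta> * W / R))) = C0 / R * S"
        by (simp add: C0_def)
      finally show ?thesis .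
    qed
    then have "grand_morrey_norm \<Omega> p \<theta> \<alpha> lam (U f) \<le> ennreal (C0 / R * S) * G"
      unfolding grand_morrey_norm_def[of _ _ _ _ _ "U f"] by (intro SUP_least) auto
    then show "grand_morrey_norm \<Omega> p \<theta> \<alpha> lam (U f)
        \<le> ennreal (C0 / \<sigma> powr (\<theta> / (p - \<sigma>)) * (SUP \<epsilon>\<in>{0<..<\<sigma>}. c \<epsilon>))
            * grand_morrey_norm \<Omega> p \<theta> \<alpha> lam f"
      by (simp add: R_def S_def G_def)
    also have "\<dots> < \<infinity>"
      using f by (simp add: grand_morrey_space_def ennreal_mult_less_top)
    finally show "U f \<in> grand_morrey_space \<Omega> p \<theta> \<alpha> lam"
      using meas by (simp add: grand_morrey_space_def)
  qed
qed

end
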